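(* For every $i\in\{0,\dots,L-1\}$, the swap transition kernel $S_i$ on $\mathbb{R}^{d_0}\times\dots\times\mathbb{R}^{d_L}$ (defined in the context) satisfies the detailed balance condition for the measure with density $\Pi$, i.e. $$\Pi(x)\,S_i(x\rightarrow y)=\Pi(y)\,S_i(y\rightarrow x),\qquad x,y\in\mathbb{R}^{d_0}\times\dots\times\mathbb{R}^{d_L},$$ where the identity is understood as an equality of measures on pairs $(x,y)$: $\Pi(x)\,dx\,S_i(x\rightarrow dy)=\Pi(y)\,dy\,S_i(y\rightarrow dx)$.
   Context: Let $L\ge 1$ and let $d_0>d_1>\dots>d_L\ge 1$ be integers. For each $i\in\{0,\dots,L\}$ let $\pi_i$ be a probability density (with respect to Lebesgue measure) on $\mathbb{R}^{d_i}$. Define $\Pi(x_0,\dots,x_L)=\pi_0(x_0)\cdots\pi_L(x_L)$ on $\mathbb{R}^{d_0}\times\dots\times\mathbb{R}^{d_L}$. For $i<L$, the coordinates of $x_i\in\mathbb{R}^{d_i}$ are split as $x_i=(\hat{x}_i,\tilde{x}_i)$ with $\hat{x}_i\in\mathbb{R}^{d_{i+1}}$ and $\tilde{x}_i\in\mathbb{R}^{d_i-d_{i+1}}$. Let $\overline{\pi}_i(\hat{x}_i)=\int\pi_i(\hat{x}_i,\tilde{x}_i)\,d\tilde{x}_i$ be the marginal density on $\mathbb{R}^{d_{i+1}}$, and let $\pi_i(\tilde{x}_i\vert\hat{x}_i)=\pi_i(\hat{x}_i,\tilde{x}_i)/\overline{\pi}_i(\hat{x}_i)$ be the conditional density. The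 density $\pi_{i+1}$ need not equal $\overline{\pi}_i$. Given $x=(\dots,\hat{x}_i,\tilde{x}_i,x_{i+1},\dots)$, a swap move between levels $i$ and $i+1$ draws $\tilde{y}_i$ from $\pi_i(\,\cdot\,\vert x_{i+1})$ and proposes $y=(\dots,x_{i+1},\tilde{y}_i,\hat{x}_i,\dots)$. That is, $\hat{y}_i=x_{i+1}$, $y_{i+1}=\hat{x}_i$, and all components $x_j$ with $j\notin\{i,i+1\}$ are unchanged. The proposal is accepted with probability $$A_i=\min\Big\{1,\ \frac{\overline{\pi}_i(x_{i+1})\,\pi_{i+1}(\hat{x}_i)}{\overline{\pi}_i(\hat{x}_i)\,\pi_{i+1}(x_{i+1})}\Big\}$$ and otherwise the chain stays at $x$. The resulting transition kernel is, in density notation with Dirac deltas, $$S_i(x\rightarrow y)=(1-A_i)\,\delta_{\{y=x\}}+A_i\,\pi_i(\tilde{y}_i\vert x_{i+1})\,\delta_{\{(\hat{y}_i,y_{i+1})=(x_{i+1},\hat{x}_i)\}}\prod_{j\notin\{i,i+1\}}\delta_{\{y_j=x_j\}},$$ i.e. $S_i(x\rightarrow dy)$ is the law of the next state. Convention: $A_i=0$ whenever $\overline{\pi}_i(x_{i+1})$ or $\overline{\pi}_i(\hat{x}_i)$ is $0$ or infinite, or $\pi_{i+1}(x_{i+1})=0$. In these cases $\pi_i(\,\cdot\,\vert x_{i+1})$, if undefined, may be taken to be any probability density. *)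

theory Defs
  imports "HOL-Probability.Probability"
begin

text \<open>
  Vectors of varying dimension are extensional functions on finite sets of coordinates:
  \<open>euc {..<n}\<close> is \<open>n\<close>-dimensional space with Lebesgue measure on its Borel sets, and
  \<open>euc {m..<n}\<close> is the space of the last \<open>n - m\<close> of \<open>n\<close> coordinates.
  A vector at level \<open>i\<close> is split into its first \<open>d (Suc i)\<close> coordinates, which are a vector of
  level \<open>Suc i\<close>, and the remaining ones, which keep their indices \<open>{d (Suc i)..<d i}\<close>.
\<close>

definition euc :: "nat set \<Rightarrow> (nat \<Rightarrow> real) measure" where
  "euc I = (\<Pi>\<^sub>M k\<in>I. lborel)"

definition state :: "nat \<Rightarrow> (nat \<Rightarrow> nat) \<Rightarrow> (nat \<Rightarrow> nat \<Rightarrow> real) measure" where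
  "state L d = (\<Pi>\<^sub>M j\<in>{..L}. euc {..<d j})"

definition prob_density :: "'a measure \<Rightarrow> ('a \<Rightarrow> real) \<Rightarrow> bool" where
  "prob_density M f \<longleftrightarrow>
     f \<in> borel_measurable M \<and> (\<forall>x\<in>space M. 0 \<le> f x) \<and> (\<integral>\<^sup>+x. ennreal (f x) \<partial>M) = 1"

definition product_density ::
    "nat \<Rightarrow> (nat \<Rightarrow> (nat \<Rightarrow> real) \<Rightarrow> real) \<Rightarrow> (nat \<Rightarrow> nat \<Rightarrow> real) \<Rightarrow> real" where
  "product_density L \<pi> x = (\<Prod>j\<le>L. \<pi> j (x j))"

definition hat :: "(nat \<Rightarrow> nat) \<Rightarrow> nat \<Rightarrow> (nat \<Rightarrow> real) \<Rightarrow> nat \<Rightarrow> real" where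
  "hat d i v = restrict v {..<d (Suc i)}"

definition join_coords ::
    "(nat \<Rightarrow> nat) \<Rightarrow> nat \<Rightarrow> (nat \<Rightarrow> real) \<Rightarrow> (nat \<Rightarrow> real) \<Rightarrow> nat \<Rightarrow> real" where
  "join_coords d i u w = merge {..<d (Suc i)} {d (Suc i)..<d i} (u, w)"

definition marginal ::
    "(nat \<Rightarrow> nat) \<Rightarrow> (nat \<Rightarrow> (nat \<Rightarrow> real) \<Rightarrow> real) \<Rightarrow> nat \<Rightarrow> (nat \<Rightarrow> real) \<Rightarrow> ennreal" where
  "marginal d \<pi> i u = (\<integral>\<^sup>+w. ennreal (\<pi> i (join_coords d i u w)) \<partial>euc {d (Suc i)..<d i})"

text \<open>
  \<open>\<rho> i u\<close> is the arbitrary density used where the conditional density given \<open>u\<close> is undefined.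
\<close>

definition conditional ::
    "(nat \<Rightarrow> nat) \<Rightarrow> (nat \<Rightarrow> (nat \<Rightarrow> real) \<Rightarrow> real) \<Rightarrow>
     (nat \<Rightarrow> (nat \<Rightarrow> real) \<Rightarrow> (nat \<Rightarrow> real) \<Rightarrow> real) \<Rightarrow>
     nat \<Rightarrow> (nat \<Rightarrow> real) \<Rightarrow> (nat \<Rightarrow> real) \<Rightarrow> ennreal" where
  "conditional d \<pi> \<rho> i u w =
     (if marginal d \<pi> i u = 0 \<or> marginal d \<pi> i u = \<infinity> then ennreal (\<rho> i u w)
      else ennreal (\<pi> i (join_coords d i u w)) / marginal d \<pi> i u)"

definition acceptance ::
    "(nat \<Rightarrow> nat) \<Rightarrow> (nat \<Rightarrow> (nat \<Rightarrow> real) \<Rightarrow> real) \<Rightarrow> nat \<Rightarrow> (nat \<Rightarrow> nat \<Rightarrow> real) \<Rightarrow> ennreal" where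
  "acceptance d \<pi> i x =
     (if marginal d \<pi> i (x (Suc i)) \<in> {0, \<infinity>} \<or> marginal d \<pi> i (hat d i (x i)) \<in> {0, \<infinity>} \<or>
         \<pi> (Suc i) (x (Suc i)) = 0
      then 0
      else min 1 ((marginal d \<pi> i (x (Suc i)) * ennreal (\<pi> (Suc i) (hat d i (x i)))) /
                  (marginal d \<pi> i (hat d i (x i)) * ennreal (\<pi> (Suc i) (x (Suc i))))))"

definition swap_point ::
    "(nat \<Rightarrow> nat) \<Rightarrow> nat \<Rightarrow> (nat \<Rightarrow> nat \<Rightarrow> real) \<Rightarrow> (nat \<Rightarrow> real) \<Rightarrow> nat \<Rightarrow> nat \<Rightarrow> real" where
  "swap_point d i x w = x(i := join_coords d i (x (Suc i)) w, Suc i := hat d i (x i))"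

definition proposal ::
    "nat \<Rightarrow> (nat \<Rightarrow> nat) \<Rightarrow> (nat \<Rightarrow> (nat \<Rightarrow> real) \<Rightarrow> real) \<Rightarrow>
     (nat \<Rightarrow> (nat \<Rightarrow> real) \<Rightarrow> (nat \<Rightarrow> real) \<Rightarrow> real) \<Rightarrow>
     nat \<Rightarrow> (nat \<Rightarrow> nat \<Rightarrow> real) \<Rightarrow> (nat \<Rightarrow> nat \<Rightarrow> real) measure" where
  "proposal L d \<pi> \<rho> i x =
     distr (density (euc {d (Suc i)..<d i}) (conditional d \<pi> \<rho> i (x (Suc i))))
       (state L d) (swap_point d i x)"

definition swap_kernel ::
    "nat \<Rightarrow> (nat \<Rightarrow> nat) \<Rightarrow> (nat \<Rightarrow> (nat \<Rightarrow> real) \<Rightarrow> real) \<Rightarrow>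
     (nat \<Rightarrow> (nat \<Rightarrow> real) \<Rightarrow> (nat \<Rightarrow> real) \<Rightarrow> real) \<Rightarrow>
     nat \<Rightarrow> (nat \<Rightarrow> nat \<Rightarrow> real) \<Rightarrow> (nat \<Rightarrow> nat \<Rightarrow> real) measure" where
  "swap_kernel L d \<pi> \<rho> i x =
     measure_of (space (state L d)) (sets (state L d))
       (\<lambda>B. (1 - acceptance d \<pi> i x) * emeasure (return (state L d) x) B +
            acceptance d \<pi> i x * emeasure (proposal L d \<pi> \<rho> i x) B)"

text \<open>
  The two sides are the measures \<open>f x dx K(x, dy)\<close> and \<open>f y dy K(y, dx)\<close> on pairs \<open>(x, y)\<close>.
\<close>

definition detailed_balance :: "'a measure \<Rightarrow> ('a \<Rightarrow> real) \<Rightarrow> ('a \<Rightarrow> 'a measure) \<Rightarrow> bool" where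
  "detailed_balance M f K \<longleftrightarrow>
     bind (density M (\<lambda>x. ennreal (f x))) (\<lambda>x. distr (K x) (M \<Otimes>\<^sub>M M) (\<lambda>y. (x, y))) =
     bind (density M (\<lambda>y. ennreal (f y))) (\<lambda>y. distr (K y) (M \<Otimes>\<^sub>M M) (\<lambda>x. (x, y)))"

text \<open>
  The function passed to \<^const>\<open>measure_of\<close> is a measure, and \<^const>\<open>swap_kernel\<close> is
  a Markov kernel, so neither \<^const>\<open>measure_of\<close> nor \<^const>\<open>bind\<close> takes a default value.
\<close>

lemma sets_swap_kernel [simp, measurable_cong]:
  "sets (swap_kernel L d \<pi> \<rho> i x) = sets (state L d)"
  by (simp add: swap_kernel_def)

lemma space_swap_kernel [simp]:
  "space (swap_kernel L d \<pi> \<rho> i x) = space (state L d)"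
  by (simp add: swap_kernel_def)

lemma acceptance_le_1: "acceptance d \<pi> i x \<le> 1"
  by (simp add: acceptance_def)

lemma emeasure_swap_kernel:
  assumes B: "B \<in> sets (state L d)"
  shows "emeasure (swap_kernel L d \<pi> \<rho> i x) B =
    (1 - acceptance d \<pi> i x) * emeasure (return (state L d) x) B +
    acceptance d \<pi> i x * emeasure (proposal L d \<pi> \<rho> i x) B"
proof (rule emeasure_measure_of[OF swap_kernel_def])
  have sp: "sets (proposal L d \<pi> \<rho> i x) = sets (state L d)"
    by (simp add: proposal_def)
  show "countably_additive (sets (swap_kernel L d \<pi> \<rho> i x))
     (\<lambda>B. (1 - acceptance d \<pi> i x) * emeasure (return (state L d) x) B +
            acceptance d \<pi> i x * emeasure (proposal L d \<pi> \<rho> i x) B)"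
    unfolding countably_additive_def
  proof (intro allI impI)
    fix A :: "nat \<Rightarrow> (nat \<Rightarrow> nat \<Rightarrow> real) set"
    assume "range A \<subseteq> sets (swap_kernel L d \<pi> \<rho> i x)" and dis: "disjoint_family A"
    then have A: "range A \<subseteq> sets (state L d)"
      by simp
    have "(\<Sum>n. (1 - acceptance d \<pi> i x) * emeasure (return (state L d) x) (A n) +
        acceptance d \<pi> i x * emeasure (proposal L d \<pi> \<rho> i x) (A n)) =
      (\<Sum>n. (1 - acceptance d \<pi> i x) * emeasure (return (state L d) x) (A n)) +
      (\<Sum>n. acceptance d \<pi> i x * emeasure (proposal L d \<pi> \<rho> i x) (A n))"
      by (rule suminf_add[symmetric]) simp_all
    also have "\<dots> = (1 - acceptance d \<pi> i x) * (\<Sum>n. emeasure (return (state L d) x) (A n)) +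
        acceptance d \<pi> i x * (\<Sum>n. emeasure (proposal L d \<pi> \<rho> i x) (A n))"
      by (simp only: ennreal_suminf_cmult)
    also have "(\<Sum>n. emeasure (return (state L d) x) (A n)) =
        emeasure (return (state L d) x) (\<Union>n. A n)"
      using A dis by (intro suminf_emeasure) auto
    also have "(\<Sum>n. emeasure (proposal L d \<pi> \<rho> i x) (A n)) =
        emeasure (proposal L d \<pi> \<rho> i x) (\<Union>n. A n)"
      using A dis sp by (intro suminf_emeasure) auto
    finally show "(\<Sum>n. (1 - acceptance d \<pi> i x) * emeasure (return (state L d) x) (A n) +
        acceptance d \<pi> i x * emeasure (proposal L d \<pi> \<rho> i x) (A n)) =
      (1 - acceptance d \<pi> i x) * emeasure (return (state L d) x) (\<Union>n. A n) +
      acceptance d \<pi> i x * emeasure (proposal L d \<pi> \<rho> i x) (\<Union>n. A n)" .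
  qed
  show "sets (state L d) \<subseteq> Pow (space (state L d))"
    by (rule sets.space_closed)
qed (use B in \<open>auto simp: positive_def\<close>)

lemma measurable_join_coords:
  assumes "d (Suc i) < d i"
  shows "(\<lambda>(u, w). join_coords d i u w) \<in>
    euc {..<d (Suc i)} \<Otimes>\<^sub>M euc {d (Suc i)..<d i} \<rightarrow>\<^sub>M euc {..<d i}"
proof -
  have "{..<d (Suc i)} \<union> {d (Suc i)..<d i} = {..<d i}"
    using assms by auto
  then show ?thesis
    using measurable_merge[of "{..<d (Suc i)}" "{d (Suc i)..<d i}" "\<lambda>_. lborel :: real measure"]
    by (simp add: euc_def join_coords_def case_prod_beta')
qed

lemma sigma_finite_euc: "finite I \<Longrightarrow> sigma_finite_measure (euc I)"
proof -
  assume "finite I"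
  interpret product_sigma_finite "\<lambda>_. lborel :: real measure"
    by standard
  show "sigma_finite_measure (euc I)"
    unfolding euc_def by (rule sigma_finite[OF \<open>finite I\<close>])
qed

context
  fixes L :: nat and d :: "nat \<Rightarrow> nat"
    and \<pi> :: "nat \<Rightarrow> (nat \<Rightarrow> real) \<Rightarrow> real"
    and \<rho> :: "nat \<Rightarrow> (nat \<Rightarrow> real) \<Rightarrow> (nat \<Rightarrow> real) \<Rightarrow> real"
    and i :: nat
  assumes d_dec: "\<And>j. j < L \<Longrightarrow> d (Suc j) < d j"
    and dens: "\<And>j. j \<le> L \<Longrightarrow> prob_density (euc {..<d j}) (\<pi> j)"
    and fallback: "\<And>j u. j < L \<Longrightarrow> u \<in> space (euc {..<d (Suc j)}) \<Longrightarrow>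
      prob_density (euc {d (Suc j)..<d j}) (\<rho> j u)"
    and i: "i < L"
begin

private lemma measurable_dens: "j \<le> L \<Longrightarrow> \<pi> j \<in> borel_measurable (euc {..<d j})"
  using dens by (auto simp: prob_density_def)

private lemma measurable_comp: "j \<le> L \<Longrightarrow> (\<lambda>x. x j) \<in> state L d \<rightarrow>\<^sub>M euc {..<d j}"
  unfolding state_def by (rule measurable_component_singleton) auto

private lemma measurable_hat: "hat d i \<in> euc {..<d i} \<rightarrow>\<^sub>M euc {..<d (Suc i)}"
  unfolding hat_def euc_def using d_dec[OF i] by (intro measurable_restrict_subset) auto

private lemma measurable_joint:
  "(\<lambda>(u, w). ennreal (\<pi> i (join_coords d i u w))) \<in>
    borel_measurable (euc {..<d (Suc i)} \<Otimes>\<^sub>M euc {d (Suc i)..<d i})"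
proof -
  have "i \<le> L" using i by simp
  from measurable_compose[OF measurable_join_coords[where d=d and i=i, OF d_dec[OF i]] measurable_dens[OF this]]
  show ?thesis
    unfolding case_prod_beta' by (rule measurable_compose[OF _ measurable_ennreal])
qed

private lemma measurable_marginal: "marginal d \<pi> i \<in> borel_measurable (euc {..<d (Suc i)})"
proof -
  interpret sigma_finite_measure "euc {d (Suc i)..<d i}"
    by (rule sigma_finite_euc) simp
  show ?thesis
    unfolding marginal_def[abs_def] by (rule borel_measurable_nn_integral[OF measurable_joint])
qed

private lemma measurable_acceptance: "acceptance d \<pi> i \<in> borel_measurable (state L d)"
proof -
  note [measurable] = measurable_marginal measurable_hat
    measurable_dens[of i] measurable_dens[of "Suc i"] measurable_comp[of i] measurable_comp[of "Suc i"]
  have [simp]: "i \<le> L" "Suc i \<le> L" using i by auto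
  show ?thesis
    unfolding acceptance_def[abs_def] by measurable
qed

private lemma measurable_swap_point:
  "(\<lambda>(x, w). swap_point d i x w) \<in> state L d \<Otimes>\<^sub>M euc {d (Suc i)..<d i} \<rightarrow>\<^sub>M state L d"
proof -
  have iL: "i \<le> L" "Suc i \<le> L" using i by auto
  have 1: "(\<lambda>p. join_coords d i (fst p (Suc i)) (snd p)) \<in>
      state L d \<Otimes>\<^sub>M euc {d (Suc i)..<d i} \<rightarrow>\<^sub>M euc {..<d i}"
  proof -
    have "(\<lambda>p. (fst p (Suc i), snd p)) \<in> state L d \<Otimes>\<^sub>M euc {d (Suc i)..<d i} \<rightarrow>\<^sub>M
        euc {..<d (Suc i)} \<Otimes>\<^sub>M euc {d (Suc i)..<d i}"
      by (intro measurable_Pair measurable_snd measurable_compose[OF measurable_fst]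
          measurable_comp[OF iL(2)])
    from measurable_compose[OF this measurable_join_coords[where d=d and i=i, OF d_dec[OF i]]]
    show ?thesis by simp
  qed
  have 2: "(\<lambda>p. hat d i (fst p i)) \<in> state L d \<Otimes>\<^sub>M euc {d (Suc i)..<d i} \<rightarrow>\<^sub>M euc {..<d (Suc i)}"
    by (intro measurable_compose[OF _ measurable_hat] measurable_compose[OF measurable_fst]
        measurable_comp iL)
  have 3: "(\<lambda>p. fst p j) \<in> state L d \<Otimes>\<^sub>M euc {d (Suc i)..<d i} \<rightarrow>\<^sub>M euc {..<d j}" if "j \<le> L" for j
    by (intro measurable_compose[OF measurable_fst] measurable_comp that)
  have sp: "fst p \<in> extensional {..L}" if "p \<in> space (state L d \<Otimes>\<^sub>M euc {d (Suc i)..<d i})" for p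
    using that by (auto simp: state_def space_pair_measure space_PiM PiE_def)
  have "(\<lambda>p. \<lambda>j\<in>{..L}. swap_point d i (fst p) (snd p) j) \<in>
      state L d \<Otimes>\<^sub>M euc {d (Suc i)..<d i} \<rightarrow>\<^sub>M state L d"
    unfolding state_def[of L d]
  proof (rule measurable_restrict, fold state_def)
    fix j assume "j \<in> {..L}"
    then show "(\<lambda>p. swap_point d i (fst p) (snd p) j) \<in>
      state L d \<Otimes>\<^sub>M euc {d (Suc i)..<d i} \<rightarrow>\<^sub>M euc {..<d j}"
      using 1 2 3[of j] by (cases "j = i"; cases "j = Suc i") (auto simp: swap_point_def)
  qed
  also have "?this \<longleftrightarrow> ?thesis"
  proof (rule measurable_cong)
    fix p assume "p \<in> space (state L d \<Otimes>\<^sub>M euc {d (Suc i)..<d i})"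
    from sp[OF this] show "(\<lambda>j\<in>{..L}. swap_point d i (fst p) (snd p) j) =
        (case p of (x, w) \<Rightarrow> swap_point d i x w)"
      using iL by (auto simp: swap_point_def fun_eq_iff extensional_def case_prod_beta')
  qed
  finally show ?thesis .
qed

private lemma prob_density_conditional:
  assumes u: "u \<in> space (euc {..<d (Suc i)})"
  shows "conditional d \<pi> \<rho> i u \<in> borel_measurable (euc {d (Suc i)..<d i})"
    and "(\<integral>\<^sup>+w. conditional d \<pi> \<rho> i u w \<partial>euc {d (Suc i)..<d i}) = 1"
proof -
  have m: "(\<lambda>w. ennreal (\<pi> i (join_coords d i u w))) \<in> borel_measurable (euc {d (Suc i)..<d i})"
    using measurable_Pair2[OF measurable_joint u] by simp
  have f: "\<rho> i u \<in> borel_measurable (euc {d (Suc i)..<d i})"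
    "(\<integral>\<^sup>+w. ennreal (\<rho> i u w) \<partial>euc {d (Suc i)..<d i}) = 1"
    using fallback[OF i u] by (auto simp: prob_density_def)
  show "conditional d \<pi> \<rho> i u \<in> borel_measurable (euc {d (Suc i)..<d i})"
    unfolding conditional_def[abs_def] using m f(1) by measurable
  show "(\<integral>\<^sup>+w. conditional d \<pi> \<rho> i u w \<partial>euc {d (Suc i)..<d i}) = 1"
  proof (cases "marginal d \<pi> i u = 0 \<or> marginal d \<pi> i u = \<infinity>")
    case True
    then show ?thesis using f(2) by (simp add: conditional_def)
  next
    case False
    then have "(\<integral>\<^sup>+w. conditional d \<pi> \<rho> i u w \<partial>euc {d (Suc i)..<d i}) =
        marginal d \<pi> i u / marginal d \<pi> i u"
      using nn_integral_divide[OF m] by (simp add: conditional_def marginal_def)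
    also have "\<dots> = 1" using False by (simp add: ennreal_divide_self less_top)
    finally show ?thesis .
  qed
qed

private lemma measurable_swap_point1:
  "x \<in> space (state L d) \<Longrightarrow> swap_point d i x \<in> euc {d (Suc i)..<d i} \<rightarrow>\<^sub>M state L d"
  using measurable_Pair2[OF measurable_swap_point] by simp

lemma emeasure_proposal:
  assumes x: "x \<in> space (state L d)" and B: "B \<in> sets (state L d)"
  shows "emeasure (proposal L d \<pi> \<rho> i x) B =
    (\<integral>\<^sup>+w. conditional d \<pi> \<rho> i (x (Suc i)) w * indicator B (swap_point d i x w)
      \<partial>euc {d (Suc i)..<d i})"
proof -
  have u: "x (Suc i) \<in> space (euc {..<d (Suc i)})"
    using measurable_space[OF measurable_comp[of "Suc i"] x] i by simp
  note [measurable] = prob_density_conditional(1)[OF u] measurable_swap_point1[OF x] B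
  show ?thesis
    unfolding proposal_def using B
    by (subst emeasure_distr, simp, simp, subst emeasure_density)
      (auto intro!: nn_integral_cong simp: indicator_def)
qed

lemma prob_space_swap_kernel:
  assumes x: "x \<in> space (state L d)"
  shows "prob_space (swap_kernel L d \<pi> \<rho> i x)"
proof
  have u: "x (Suc i) \<in> space (euc {..<d (Suc i)})"
    using measurable_space[OF measurable_comp[of "Suc i"] x] i by simp
  have "emeasure (proposal L d \<pi> \<rho> i x) (space (state L d)) = 
     (\<integral>\<^sup>+w. conditional d \<pi> \<rho> i (x (Suc i)) w \<partial>euc {d (Suc i)..<d i})"
    using measurable_space[OF measurable_swap_point1[OF x]]
    by (auto simp: emeasure_proposal[OF x] intro!: nn_integral_cong)
  then have "emeasure (proposal L d \<pi> \<rho> i x) (space (state L d)) = 1"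
    by (simp add: prob_density_conditional(2)[OF u])
  then show "emeasure (swap_kernel L d \<pi> \<rho> i x) (space (swap_kernel L d \<pi> \<rho> i x)) = 1"
    using x acceptance_le_1[of d \<pi> i x] by (simp add: emeasure_swap_kernel diff_add_cancel_ennreal)
qed

lemma measurable_swap_kernel: "swap_kernel L d \<pi> \<rho> i \<in> state L d \<rightarrow>\<^sub>M prob_algebra (state L d)"
proof (rule measurable_prob_algebraI)
  show "swap_kernel L d \<pi> \<rho> i \<in> state L d \<rightarrow>\<^sub>M subprob_algebra (state L d)"
  proof (rule measurable_subprob_algebra)
    fix B assume B: "B \<in> sets (state L d)"
    interpret sigma_finite_measure "euc {d (Suc i)..<d i}"
      by (rule sigma_finite_euc) simp
    have iL: "Suc i \<le> L" using i by simp
    define g where "g x = (\<integral>\<^sup>+w. ennreal (\<pi> i (join_coords d i (x (Suc i)) w)) /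
      marginal d \<pi> i (x (Suc i)) * indicator B (swap_point d i x w) \<partial>euc {d (Suc i)..<d i})" for x
    have "(\<lambda>p. (fst p (Suc i), snd p)) \<in> state L d \<Otimes>\<^sub>M euc {d (Suc i)..<d i} \<rightarrow>\<^sub>M
        euc {..<d (Suc i)} \<Otimes>\<^sub>M euc {d (Suc i)..<d i}"
      by (intro measurable_Pair measurable_snd measurable_compose[OF measurable_fst]
          measurable_comp[OF iL])
    from measurable_compose[OF this measurable_joint]
    have [measurable]: "(\<lambda>p. ennreal (\<pi> i (join_coords d i (fst p (Suc i)) (snd p)))) \<in>
        borel_measurable (state L d \<Otimes>\<^sub>M euc {d (Suc i)..<d i})"
      by simp
    note [measurable] = measurable_marginal measurable_acceptance measurable_comp[OF iL] B
      measurable_swap_point[unfolded case_prod_beta']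
    have [measurable]: "g \<in> borel_measurable (state L d)"
      unfolding g_def by (rule borel_measurable_nn_integral) (simp add: case_prod_beta')
    have "acceptance d \<pi> i x * emeasure (proposal L d \<pi> \<rho> i x) B = acceptance d \<pi> i x * g x"
      if "x \<in> space (state L d)" for x
      by (cases "acceptance d \<pi> i x = 0")
        (auto simp: emeasure_proposal[OF that B] g_def conditional_def acceptance_def split: if_splits)
    then have "(\<lambda>x. emeasure (swap_kernel L d \<pi> \<rho> i x) B) \<in> borel_measurable (state L d) \<longleftrightarrow>
      (\<lambda>x. (1 - acceptance d \<pi> i x) * indicator B x + acceptance d \<pi> i x * g x) \<in>
        borel_measurable (state L d)"
      using B by (intro measurable_cong) (simp add: emeasure_swap_kernel)
    also have \<dots> by measurable
    finally show "(\<lambda>x. emeasure (swap_kernel L d \<pi> \<rho> i x) B) \<in> borel_measurable (state L d)" .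
  qed (auto intro: prob_space_imp_subprob_space prob_space_swap_kernel)
qed (rule prob_space_swap_kernel)

end

end

theory Submission
  imports Defs
begin

text \<open>
  Write \<open>z\<close> for the components of the state outside levels \<open>i\<close> and \<open>Suc i\<close>, and \<open>a\<close> for
  \<open>x i\<close>. A proposal draws \<open>w\<close>, which together with \<open>x (Suc i)\<close> makes up a second point
  \<open>a' = join_coords d i (x (Suc i)) w\<close> of level \<open>i\<close>. In the variables \<open>(z, a, a')\<close> the state is
  \<open>(z, a, hat a')\<close>, the proposed state is \<open>(z, a', hat a)\<close>, and the reverse proposal from there
  has to draw \<open>tilde a\<close>, the last coordinates of \<open>a\<close>. A swap is thus the exchange of \<open>a\<close> and \<open>a'\<close>,
  which preserves the measure \<open>dx dw = dz da da'\<close> by Fubini's theorem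
  (\<open>nn_integral_swap_point\<close>).

  The density of an accepted swap with respect to \<open>dz da da'\<close> is, with \<open>m\<close> the marginal of \<open>\<pi> i\<close>
  and \<open>p = \<pi> (Suc i)\<close>,
  \<open>\<Pi>(x) \<sqdot> A(x) \<sqdot> \<pi> i a' / m(hat a') =
  rest(z) \<sqdot> \<pi> i a \<sqdot> \<pi> i a' \<sqdot> min (p(hat a') / m(hat a')) (p(hat a) / m(hat a))\<close>,
  which is visibly symmetric in \<open>a\<close> and \<open>a'\<close>. This is the usual Metropolis-Hastings cancellation
  (\<open>density_acceptance_conditional\<close>). With the quotient \<open>p / m\<close> read as \<open>0\<close> where \<open>m\<close> is \<open>0\<close> or
  infinite, it holds at every point, and it removes the fallback density, which is only
  measurable in \<open>w\<close> for each fixed \<open>u\<close>, from all integrals over states.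

  Rejected proposals contribute a measure on the diagonal, which is symmetric anyway.
\<close>

section \<open>Testing detailed balance on sets of pairs\<close>

lemma converse_in_sets_pair:
  assumes "A \<in> sets (M \<Otimes>\<^sub>M M)"
  shows "A\<inverse> \<in> sets (M \<Otimes>\<^sub>M M)"
proof -
  have "A\<inverse> = (\<lambda>(x, y). (y, x)) -` A \<inter> space (M \<Otimes>\<^sub>M M)"
    using sets.sets_into_space[OF assms] by (auto simp: space_pair_measure)
  then show ?thesis
    using measurable_sets[OF measurable_pair_swap' assms] by simp
qed

text \<open>
  The second measure in detailed balance is the first one with the two components exchanged, so
  it gives \<open>A\<close> the mass that the first one gives to the converse of \<open>A\<close>.
\<close>

lemma detailed_balanceI:
  assumes f: "f \<in> borel_measurable M"
    and K: "K \<in> M \<rightarrow>\<^sub>M prob_algebra M"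
    and sym: "\<And>A. A \<in> sets (M \<Otimes>\<^sub>M M) \<Longrightarrow>
      (\<integral>\<^sup>+x. ennreal (f x) * emeasure (K x) (Pair x -` A) \<partial>M) =
      (\<integral>\<^sup>+x. ennreal (f x) * emeasure (K x) (Pair x -` (A\<inverse>)) \<partial>M)"
  shows "detailed_balance M f K"
proof (cases "space M = {}")
  case True
  then show ?thesis by (simp add: detailed_balance_def bind_empty)
next
  case False
  define N where "N = density M (\<lambda>x. ennreal (f x))"
  have sets_N: "sets N = sets M" and ne: "space N \<noteq> {}"
    using False by (simp_all add: N_def)
  have K': "K \<in> N \<rightarrow>\<^sub>M subprob_algebra M"
    using measurable_prob_algebraD[OF K] by (simp cong: measurable_cong_sets add: N_def)
  \<comment> \<open>Both sides are of this form, for \<open>g x y = (x, y)\<close> and for \<open>g x y = (y, x)\<close>.\<close>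
  have kern: "(\<lambda>x. distr (K x) (M \<Otimes>\<^sub>M M) (\<lambda>y. g x y)) \<in> N \<rightarrow>\<^sub>M subprob_algebra (M \<Otimes>\<^sub>M M)"
    and emeas: "A \<in> sets (M \<Otimes>\<^sub>M M) \<Longrightarrow>
      emeasure (bind N (\<lambda>x. distr (K x) (M \<Otimes>\<^sub>M M) (\<lambda>y. g x y))) A =
      (\<integral>\<^sup>+x. ennreal (f x) * emeasure (K x) (g x -` A \<inter> space M) \<partial>M)"
    if g: "case_prod g \<in> M \<Otimes>\<^sub>M M \<rightarrow>\<^sub>M M \<Otimes>\<^sub>M M" for g A
  proof -
    show k: "(\<lambda>x. distr (K x) (M \<Otimes>\<^sub>M M) (\<lambda>y. g x y)) \<in> N \<rightarrow>\<^sub>M subprob_algebra (M \<Otimes>\<^sub>M M)"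
      using g measurable_cong_sets[OF sets_pair_measure_cong[OF sets_N refl] refl, of M "M \<Otimes>\<^sub>M M"]
      by (intro measurable_distr2[OF _ K']) simp
    assume A: "A \<in> sets (M \<Otimes>\<^sub>M M)"
    have "emeasure (bind N (\<lambda>x. distr (K x) (M \<Otimes>\<^sub>M M) (g x))) A =
        (\<integral>\<^sup>+x. emeasure (distr (K x) (M \<Otimes>\<^sub>M M) (g x)) A \<partial>N)"
      by (rule emeasure_bind[OF ne k A])
    also have "\<dots> = (\<integral>\<^sup>+x. ennreal (f x) * emeasure (distr (K x) (M \<Otimes>\<^sub>M M) (g x)) A \<partial>M)"
      unfolding N_def
    proof (rule nn_integral_density)
      show "(\<lambda>x. emeasure (distr (K x) (M \<Otimes>\<^sub>M M) (g x)) A) \<in> borel_measurable M"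
        using measurable_emeasure_kernel[OF k A] by (simp add: N_def)
    qed (use f in simp)
    also have "\<dots> = (\<integral>\<^sup>+x. ennreal (f x) * emeasure (K x) (g x -` A \<inter> space M) \<partial>M)"
    proof (rule nn_integral_cong)
      fix x assume x: "x \<in> space M"
      then have sK: "sets (K x) = sets M"
        using measurable_space[OF K x] by (simp add: space_prob_algebra)
      have "g x \<in> M \<rightarrow>\<^sub>M M \<Otimes>\<^sub>M M"
        using measurable_Pair2[OF g x] by simp
      then show "ennreal (f x) * emeasure (distr (K x) (M \<Otimes>\<^sub>M M) (g x)) A =
          ennreal (f x) * emeasure (K x) (g x -` A \<inter> space M)"
        using A sK sets_eq_imp_space_eq[OF sK]
        by (subst emeasure_distr) (auto cong: measurable_cong_sets)
    qed
    finally show "emeasure (bind N (\<lambda>x. distr (K x) (M \<Otimes>\<^sub>M M) (\<lambda>y. g x y))) A =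
      (\<integral>\<^sup>+x. ennreal (f x) * emeasure (K x) (g x -` A \<inter> space M) \<partial>M)" .
  qed
  have m: "case_prod Pair \<in> M \<Otimes>\<^sub>M M \<rightarrow>\<^sub>M M \<Otimes>\<^sub>M M"
    "case_prod (\<lambda>x y. (y, x)) \<in> M \<Otimes>\<^sub>M M \<rightarrow>\<^sub>M M \<Otimes>\<^sub>M M"
    by simp_all
  have "bind N (\<lambda>x. distr (K x) (M \<Otimes>\<^sub>M M) (\<lambda>y. (x, y))) =
      bind N (\<lambda>y. distr (K y) (M \<Otimes>\<^sub>M M) (\<lambda>x. (x, y)))"
  proof (rule measure_eqI)
    fix A assume "A \<in> sets (bind N (\<lambda>x. distr (K x) (M \<Otimes>\<^sub>M M) (\<lambda>y. (x, y))))"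
    then have A: "A \<in> sets (M \<Otimes>\<^sub>M M)"
      by (simp add: sets_bind[OF sets_kernel[OF kern[OF m(1)]] ne])
    have sec: "Pair x -` A \<inter> space M = Pair x -` A"
      "(\<lambda>y. (y, x)) -` A \<inter> space M = Pair x -` (A\<inverse>)" for x
      using sets.sets_into_space[OF A] by (auto simp: space_pair_measure)
    show "emeasure (bind N (\<lambda>x. distr (K x) (M \<Otimes>\<^sub>M M) (\<lambda>y. (x, y)))) A =
      emeasure (bind N (\<lambda>y. distr (K y) (M \<Otimes>\<^sub>M M) (\<lambda>x. (x, y)))) A"
      unfolding emeas[OF m(1) A] emeas[OF m(2) A] sec by (rule sym[OF A])
  qed (simp add: sets_bind[OF sets_kernel[OF kern[OF m(1)]] ne]
      sets_bind[OF sets_kernel[OF kern[OF m(2)]] ne])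
  then show ?thesis
    by (simp add: detailed_balance_def N_def)
qed

section \<open>A swap exchanges two points of the finer level\<close>

definition tilde :: "(nat \<Rightarrow> nat) \<Rightarrow> nat \<Rightarrow> (nat \<Rightarrow> real) \<Rightarrow> nat \<Rightarrow> real" where
  "tilde d i v = restrict v {d (Suc i)..<d i}"

lemma hat_join_coords:
  assumes "u \<in> space (euc {..<d (Suc i)})"
  shows "hat d i (join_coords d i u w) = u"
proof -
  have "{..<d (Suc i)} \<inter> {d (Suc i)..<d i} = {}"
    by auto
  then show ?thesis
    using assms
    by (auto simp: hat_def join_coords_def euc_def space_PiM PiE_def extensional_restrict)
qed

lemma tilde_join_coords:
  assumes "w \<in> space (euc {d (Suc i)..<d i})"
  shows "tilde d i (join_coords d i u w) = w"
proof -
  have "{..<d (Suc i)} \<inter> {d (Suc i)..<d i} = {}"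
    by auto
  then show ?thesis
    using assms
    by (auto simp: tilde_def join_coords_def euc_def space_PiM PiE_def extensional_restrict)
qed

context
  fixes L :: nat and d :: "nat \<Rightarrow> nat" and i :: nat
  assumes dec: "d (Suc i) < d i" and iL: "i < L"
begin

lemma join_hat_tilde:
  assumes "a \<in> space (euc {..<d i})"
  shows "join_coords d i (hat d i a) (tilde d i a) = a"
proof -
  have "{..<d (Suc i)} \<union> {d (Suc i)..<d i} = {..<d i}"
    using dec by auto
  then show ?thesis
    using assms
    by (simp add: join_coords_def hat_def tilde_def euc_def space_PiM PiE_def extensional_restrict)
qed

lemma measurable_hat [measurable]: "hat d i \<in> euc {..<d i} \<rightarrow>\<^sub>M euc {..<d (Suc i)}"
  unfolding hat_def euc_def using dec by (intro measurable_restrict_subset) auto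

lemma measurable_tilde [measurable]: "tilde d i \<in> euc {..<d i} \<rightarrow>\<^sub>M euc {d (Suc i)..<d i}"
  unfolding tilde_def euc_def by (intro measurable_restrict_subset) auto

lemma measurable_join [measurable (raw)]:
  assumes "f \<in> N \<rightarrow>\<^sub>M euc {..<d (Suc i)}" "g \<in> N \<rightarrow>\<^sub>M euc {d (Suc i)..<d i}"
  shows "(\<lambda>x. join_coords d i (f x) (g x)) \<in> N \<rightarrow>\<^sub>M euc {..<d i}"
  using measurable_compose[OF measurable_Pair[OF assms] measurable_join_coords[of d i, OF dec]]
  by simp

lemma measurable_level: "j \<le> L \<Longrightarrow> (\<lambda>x. x j) \<in> state L d \<rightarrow>\<^sub>M euc {..<d j}"
  unfolding state_def by (rule measurable_component_singleton) auto

lemma measurable_levels [measurable]: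
  "(\<lambda>x. x i) \<in> state L d \<rightarrow>\<^sub>M euc {..<d i}"
  "(\<lambda>x. x (Suc i)) \<in> state L d \<rightarrow>\<^sub>M euc {..<d (Suc i)}"
  using iL by (auto intro: measurable_level)

text \<open>
  The set \<open>J\<close> covers both ways in which states are built: from a state, whose levels \<open>i\<close> and
  \<open>Suc i\<close> are overwritten, and from a vector \<open>z\<close> of the other levels only.
\<close>

lemma measurable_update_levels:
  assumes "f \<in> N \<rightarrow>\<^sub>M PiM J (\<lambda>j. euc {..<d j})" "{..L} - {i, Suc i} \<subseteq> J" "J \<subseteq> {..L}"
    and g: "g \<in> N \<rightarrow>\<^sub>M euc {..<d i}" and h: "h \<in> N \<rightarrow>\<^sub>M euc {..<d (Suc i)}"
  shows "(\<lambda>x. (f x)(i := g x, Suc i := h x)) \<in> N \<rightarrow>\<^sub>M state L d"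
  unfolding state_def using iL assms(2,3)
  by (intro measurable_fun_upd[OF _ measurable_fun_upd[OF _ assms(1) g] h, of _ "insert i J"]) auto

lemma measurable_swap_point [measurable (raw)]:
  assumes f [measurable]: "f \<in> N \<rightarrow>\<^sub>M state L d" and [measurable]: "g \<in> N \<rightarrow>\<^sub>M euc {d (Suc i)..<d i}"
  shows "(\<lambda>x. swap_point d i (f x) (g x)) \<in> N \<rightarrow>\<^sub>M state L d"
  unfolding swap_point_def
  by (rule measurable_update_levels[where J = "{..L}"]) (use f in \<open>auto simp flip: state_def\<close>)

lemma nn_integral_euc_join:
  assumes f: "f \<in> borel_measurable (euc {..<d i})"
  shows "(\<integral>\<^sup>+a. f a \<partial>euc {..<d i}) =
    (\<integral>\<^sup>+u. \<integral>\<^sup>+w. f (join_coords d i u w) \<partial>euc {d (Suc i)..<d i} \<partial>euc {..<d (Suc i)})"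
proof -
  interpret product_sigma_finite "\<lambda>_. lborel :: real measure"
    by standard
  have "{..<d (Suc i)} \<union> {d (Suc i)..<d i} = {..<d i}" "{..<d (Suc i)} \<inter> {d (Suc i)..<d i} = {}"
    using dec by auto
  then show ?thesis
    using product_nn_integral_fold[of "{..<d (Suc i)}" "{d (Suc i)..<d i}" f] f
    by (simp add: euc_def join_coords_def)
qed

lemma nn_integral_state_levels:
  assumes f [measurable]: "f \<in> borel_measurable (state L d)"
  shows "(\<integral>\<^sup>+x. f x \<partial>state L d) =
    (\<integral>\<^sup>+z. \<integral>\<^sup>+a. \<integral>\<^sup>+b. f (z(i := a, Suc i := b))
      \<partial>euc {..<d (Suc i)} \<partial>euc {..<d i} \<partial>PiM ({..L} - {i, Suc i}) (\<lambda>j. euc {..<d j}))"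
proof -
  interpret product_sigma_finite "\<lambda>j. euc {..<d j}"
    by (simp add: product_sigma_finite_def sigma_finite_euc)
  interpret c: sigma_finite_measure "euc {..<d (Suc i)}"
    by (rule sigma_finite_euc) simp
  define J where "J = {..L} - {i, Suc i}"
  have J: "finite J" "i \<notin> J" "finite (insert i J)" "Suc i \<notin> insert i J"
    "insert (Suc i) (insert i J) = {..L}"
    using iL by (auto simp: J_def)
  have f' [measurable]: "f \<in> borel_measurable (PiM (insert (Suc i) (insert i J)) (\<lambda>j. euc {..<d j}))"
    using f by (simp add: state_def J)
  have "(\<integral>\<^sup>+x. f x \<partial>state L d) =
      (\<integral>\<^sup>+x. \<integral>\<^sup>+b. f (x(Suc i := b)) \<partial>euc {..<d (Suc i)} \<partial>PiM (insert i J) (\<lambda>j. euc {..<d j}))"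
    using product_nn_integral_insert[OF J(3,4) f'] by (simp add: state_def J(5))
  also have "\<dots> = (\<integral>\<^sup>+z. \<integral>\<^sup>+a. \<integral>\<^sup>+b. f (z(i := a, Suc i := b))
      \<partial>euc {..<d (Suc i)} \<partial>euc {..<d i} \<partial>PiM J (\<lambda>j. euc {..<d j}))"
    by (rule product_nn_integral_insert[OF J(1,2)]) measurable
  finally show ?thesis
    by (simp add: J_def)
qed

text \<open>
  The change of variables from \<open>(x, w)\<close> to \<open>(z, a, a')\<close>: level \<open>Suc i\<close> of the state and the
  draw \<open>w\<close> are the first and the last coordinates of \<open>a'\<close>.
\<close>

lemma nn_integral_state_two_points:
  assumes H [measurable]: "case_prod H \<in> borel_measurable (state L d \<Otimes>\<^sub>M euc {d (Suc i)..<d i})"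
  shows "(\<integral>\<^sup>+x. \<integral>\<^sup>+w. H x w \<partial>euc {d (Suc i)..<d i} \<partial>state L d) =
    (\<integral>\<^sup>+z. \<integral>\<^sup>+a. \<integral>\<^sup>+a'. H (z(i := a, Suc i := hat d i a')) (tilde d i a')
      \<partial>euc {..<d i} \<partial>euc {..<d i} \<partial>PiM ({..L} - {i, Suc i}) (\<lambda>j. euc {..<d j}))"
proof -
  interpret w: sigma_finite_measure "euc {d (Suc i)..<d i}"
    by (rule sigma_finite_euc) simp
  have "(\<integral>\<^sup>+x. \<integral>\<^sup>+w. H x w \<partial>euc {d (Suc i)..<d i} \<partial>state L d) =
    (\<integral>\<^sup>+z. \<integral>\<^sup>+a. \<integral>\<^sup>+b. \<integral>\<^sup>+w. H (z(i := a, Suc i := b)) w \<partial>euc {d (Suc i)..<d i}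
      \<partial>euc {..<d (Suc i)} \<partial>euc {..<d i} \<partial>PiM ({..L} - {i, Suc i}) (\<lambda>j. euc {..<d j}))"
    by (rule nn_integral_state_levels) measurable
  also have "\<dots> = (\<integral>\<^sup>+z. \<integral>\<^sup>+a. \<integral>\<^sup>+a'. H (z(i := a, Suc i := hat d i a')) (tilde d i a')
      \<partial>euc {..<d i} \<partial>euc {..<d i} \<partial>PiM ({..L} - {i, Suc i}) (\<lambda>j. euc {..<d j}))"
  proof (intro nn_integral_cong)
    fix z a assume z: "z \<in> space (PiM ({..L} - {i, Suc i}) (\<lambda>j. euc {..<d j}))"
      and a: "a \<in> space (euc {..<d i})"
    have "(\<lambda>a'. z(i := a, Suc i := hat d i a')) \<in> euc {..<d i} \<rightarrow>\<^sub>M state L d"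
      by (rule measurable_update_levels[where J = "{..L} - {i, Suc i}"]) (use z a in auto)
    then have "(\<lambda>a'. H (z(i := a, Suc i := hat d i a')) (tilde d i a')) \<in>
        borel_measurable (euc {..<d i})"
      by measurable
    from nn_integral_euc_join[OF this]
    show "(\<integral>\<^sup>+b. \<integral>\<^sup>+w. H (z(i := a, Suc i := b)) w \<partial>euc {d (Suc i)..<d i} \<partial>euc {..<d (Suc i)}) =
        (\<integral>\<^sup>+a'. H (z(i := a, Suc i := hat d i a')) (tilde d i a') \<partial>euc {..<d i})"
      by (auto simp: hat_join_coords tilde_join_coords intro!: nn_integral_cong)
  qed
  finally show ?thesis .
qed

text \<open>
  Invariance of \<open>dx dw\<close> under the map from a state and a draw to the proposed state and the draw
  that leads back: in the variables \<open>(z, a, a')\<close> this map exchanges \<open>a\<close> and \<open>a'\<close>.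
\<close>

lemma nn_integral_swap_point:
  assumes H [measurable]: "case_prod H \<in> borel_measurable (state L d \<Otimes>\<^sub>M euc {d (Suc i)..<d i})"
  shows "(\<integral>\<^sup>+x. \<integral>\<^sup>+w. H (swap_point d i x w) (tilde d i (x i)) \<partial>euc {d (Suc i)..<d i} \<partial>state L d) =
    (\<integral>\<^sup>+x. \<integral>\<^sup>+w. H x w \<partial>euc {d (Suc i)..<d i} \<partial>state L d)"
proof -
  interpret c: sigma_finite_measure "euc {..<d i}"
    by (rule sigma_finite_euc) simp
  interpret pair_sigma_finite "euc {..<d i}" "euc {..<d i}" ..
  have "(\<integral>\<^sup>+x. \<integral>\<^sup>+w. H (swap_point d i x w) (tilde d i (x i)) \<partial>euc {d (Suc i)..<d i} \<partial>state L d) =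
    (\<integral>\<^sup>+z. \<integral>\<^sup>+a. \<integral>\<^sup>+a'. H (z(i := a', Suc i := hat d i a)) (tilde d i a)
      \<partial>euc {..<d i} \<partial>euc {..<d i} \<partial>PiM ({..L} - {i, Suc i}) (\<lambda>j. euc {..<d j}))"
    by (subst nn_integral_state_two_points, measurable)
      (auto simp: swap_point_def join_hat_tilde fun_upd_twist intro!: nn_integral_cong)
  also have "\<dots> = (\<integral>\<^sup>+z. \<integral>\<^sup>+a'. \<integral>\<^sup>+a. H (z(i := a', Suc i := hat d i a)) (tilde d i a)
      \<partial>euc {..<d i} \<partial>euc {..<d i} \<partial>PiM ({..L} - {i, Suc i}) (\<lambda>j. euc {..<d j}))"
  proof (rule nn_integral_cong, rule Fubini')
    fix z assume z: "z \<in> space (PiM ({..L} - {i, Suc i}) (\<lambda>j. euc {..<d j}))"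
    have "(\<lambda>p. z(i := fst p, Suc i := hat d i (snd p))) \<in> euc {..<d i} \<Otimes>\<^sub>M euc {..<d i} \<rightarrow>\<^sub>M state L d"
      by (rule measurable_update_levels[where J = "{..L} - {i, Suc i}"]) (use z in auto)
    then show "(\<lambda>(a', a). H (z(i := a', Suc i := hat d i a)) (tilde d i a)) \<in>
        borel_measurable (euc {..<d i} \<Otimes>\<^sub>M euc {..<d i})"
      by measurable
  qed
  also have "\<dots> = (\<integral>\<^sup>+x. \<integral>\<^sup>+w. H x w \<partial>euc {d (Suc i)..<d i} \<partial>state L d)"
    by (rule nn_integral_state_two_points[OF H, symmetric])
  finally show ?thesis .
qed

end

section \<open>The flux of accepted swaps is symmetric\<close>

text \<open>
  The value \<open>0\<close> where the marginal is \<open>0\<close> or infinite makes the minimum of two such ratios vanish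
  exactly where the acceptance probability is \<open>0\<close> by convention or by a zero of \<open>\<pi> (Suc i)\<close>.
\<close>

definition level_ratio ::
    "(nat \<Rightarrow> nat) \<Rightarrow> (nat \<Rightarrow> (nat \<Rightarrow> real) \<Rightarrow> real) \<Rightarrow> nat \<Rightarrow> (nat \<Rightarrow> real) \<Rightarrow> ennreal" where
  "level_ratio d \<pi> i u =
     (if marginal d \<pi> i u \<in> {0, \<infinity>} then 0 else ennreal (\<pi> (Suc i) u) / marginal d \<pi> i u)"

text \<open>
  The density of accepted moves with respect to \<open>dx dw\<close>, written so that exchanging \<open>x i\<close> with
  \<open>join_coords d i (x (Suc i)) w\<close> only permutes
  its factors and the arguments of the minimum.
\<close>

definition flux ::
    "nat \<Rightarrow> (nat \<Rightarrow> nat) \<Rightarrow> (nat \<Rightarrow> (nat \<Rightarrow> real) \<Rightarrow> real) \<Rightarrow>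
     nat \<Rightarrow> (nat \<Rightarrow> nat \<Rightarrow> real) \<Rightarrow> (nat \<Rightarrow> real) \<Rightarrow> ennreal" where
  "flux L d \<pi> i x w =
     ennreal (\<Prod>j\<in>{..L} - {i, Suc i}. \<pi> j (x j)) *
     (ennreal (\<pi> i (x i)) * ennreal (\<pi> i (join_coords d i (x (Suc i)) w))) *
     min (level_ratio d \<pi> i (x (Suc i))) (level_ratio d \<pi> i (hat d i (x i)))"

text \<open>
  The Metropolis-Hastings cancellation: multiplying out, \<open>p' min 1 (m' p / (m p'))\<close> is
  \<open>m' min (p' / m') (p / m)\<close>, and the factor \<open>m'\<close> cancels the normalisation \<open>c / m'\<close> of the
  conditional density.
\<close>

lemma min_acceptance_ratio:
  fixes m m' c :: ennreal and p p' :: real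
  assumes m: "m \<noteq> 0" "m \<noteq> \<infinity>" "m' \<noteq> 0" "m' \<noteq> \<infinity>" and p: "0 \<le> p" "0 < p'"
  shows "ennreal p' * min 1 ((m' * ennreal p) / (m * ennreal p')) * (c / m') =
    c * min (ennreal p' / m') (ennreal p / m)"
proof -
  obtain r where r: "m = ennreal r" "0 < r"
    using m by (cases m) (auto simp: ennreal_eq_0_iff le_less)
  obtain r' where r': "m' = ennreal r'" "0 < r'"
    using m by (cases m') (auto simp: ennreal_eq_0_iff le_less)
  have "ennreal p' * min 1 ((m' * ennreal p) / (m * ennreal p')) =
      ennreal (p' * min 1 ((r' * p) / (r * p')))"
    using r r' p by (simp add: divide_ennreal min_ennreal flip: ennreal_1 ennreal_mult)
  also have "p' * min 1 ((r' * p) / (r * p')) = r' * min (p' / r') (p / r)"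
    using r r' p by (simp add: min_def field_simps)
  also have "ennreal \<dots> = m' * min (ennreal p' / m') (ennreal p / m)"
    using r r' p by (simp add: divide_ennreal ennreal_mult flip: min_ennreal)
  finally have "ennreal p' * min 1 ((m' * ennreal p) / (m * ennreal p')) * (c / m') =
      (m' / m') * (c * min (ennreal p' / m') (ennreal p / m))"
    by (simp add: divide_ennreal_def ac_simps)
  also have "m' / m' = 1"
    using m by (simp add: ennreal_divide_self less_top)
  finally show ?thesis by simp
qed

lemma flux_swap_point:
  assumes "d (Suc i) < d i" "i < L"
    and x: "x \<in> space (state L d)" and w: "w \<in> space (euc {d (Suc i)..<d i})"
  shows "flux L d \<pi> i (swap_point d i x w) (tilde d i (x i)) = flux L d \<pi> i x w"
proof -
  have "x (Suc i) \<in> space (euc {..<d (Suc i)})" "x i \<in> space (euc {..<d i})"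
    using assms by (auto simp: state_def space_PiM)
  then show ?thesis
    using assms
    by (simp add: flux_def swap_point_def hat_join_coords join_hat_tilde min.commute mult.commute)
qed

lemma swap_point_swap_point:
  assumes "d (Suc i) < d i" "i < L"
    and x: "x \<in> space (state L d)" and w: "w \<in> space (euc {d (Suc i)..<d i})"
  shows "swap_point d i (swap_point d i x w) (tilde d i (x i)) = x"
proof -
  have "x (Suc i) \<in> space (euc {..<d (Suc i)})" "x i \<in> space (euc {..<d i})"
    using assms by (auto simp: state_def space_PiM)
  then show ?thesis
    using assms by (simp add: swap_point_def hat_join_coords join_hat_tilde fun_eq_iff)
qed

context
  fixes L :: nat and d :: "nat \<Rightarrow> nat"
    and \<pi> :: "nat \<Rightarrow> (nat \<Rightarrow> real) \<Rightarrow> real"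
    and \<rho> :: "nat \<Rightarrow> (nat \<Rightarrow> real) \<Rightarrow> (nat \<Rightarrow> real) \<Rightarrow> real"
    and i :: nat
  assumes d_dec: "\<And>j. j < L \<Longrightarrow> d (Suc j) < d j"
    and dens: "\<And>j. j \<le> L \<Longrightarrow> prob_density (euc {..<d j}) (\<pi> j)"
    and fallback: "\<And>j u. j < L \<Longrightarrow> u \<in> space (euc {..<d (Suc j)}) \<Longrightarrow>
      prob_density (euc {d (Suc j)..<d j}) (\<rho> j u)"
    and iL: "i < L"
begin

lemmas dim_dec = d_dec[OF iL]

lemmas [measurable] =
  measurable_hat[of d, OF dim_dec iL] measurable_levels[of d, OF dim_dec iL]

lemmas [measurable (raw)] =
  measurable_join[of d, OF dim_dec iL] measurable_swap_point[of d, OF dim_dec iL]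

lemma measurable_densities [measurable]:
  "\<pi> i \<in> borel_measurable (euc {..<d i})"
  "\<pi> (Suc i) \<in> borel_measurable (euc {..<d (Suc i)})"
  using dens iL by (auto simp: prob_density_def)

lemma measurable_marginal [measurable]: "marginal d \<pi> i \<in> borel_measurable (euc {..<d (Suc i)})"
proof -
  interpret sigma_finite_measure "euc {d (Suc i)..<d i}"
    by (rule sigma_finite_euc) simp
  show ?thesis
    unfolding marginal_def[abs_def] by measurable
qed

lemma measurable_acceptance [measurable]: "acceptance d \<pi> i \<in> borel_measurable (state L d)"
  unfolding acceptance_def[abs_def] by measurable

lemma measurable_prod_densities:
  assumes "J \<subseteq> {..L}"
  shows "(\<lambda>x. \<Prod>j\<in>J. \<pi> j (x j)) \<in> borel_measurable (state L d)"
proof (rule borel_measurable_prod)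
  fix j assume "j \<in> J"
  then show "(\<lambda>x. \<pi> j (x j)) \<in> borel_measurable (state L d)"
    using assms dens
    by (intro measurable_compose[OF measurable_level[of d, OF dim_dec iL]]) (auto simp: prob_density_def)
qed

lemma measurable_product_density [measurable]:
  "product_density L \<pi> \<in> borel_measurable (state L d)"
  unfolding product_density_def[abs_def] by (rule measurable_prod_densities) simp

lemma measurable_level_ratio [measurable]:
  "level_ratio d \<pi> i \<in> borel_measurable (euc {..<d (Suc i)})"
  unfolding level_ratio_def[abs_def] by measurable

lemma measurable_flux [measurable]:
  "(\<lambda>(x, w). flux L d \<pi> i x w) \<in> borel_measurable (state L d \<Otimes>\<^sub>M euc {d (Suc i)..<d i})"
proof -
  have [measurable]: "(\<lambda>x. \<Prod>j\<in>{..L} - {i, Suc i}. \<pi> j (x j)) \<in> borel_measurable (state L d)"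
    by (rule measurable_prod_densities) auto
  show ?thesis
    unfolding flux_def by measurable
qed

lemma density_acceptance_conditional:
  assumes x: "x \<in> space (state L d)" and w: "w \<in> space (euc {d (Suc i)..<d i})"
  shows "ennreal (product_density L \<pi> x) * acceptance d \<pi> i x *
      conditional d \<pi> \<rho> i (x (Suc i)) w = flux L d \<pi> i x w"
proof -
  have sp: "x j \<in> space (euc {..<d j})" if "j \<le> L" for j
    using x that by (auto simp: state_def space_PiM)
  have nonneg: "0 \<le> \<pi> j (x j)" if "j \<le> L" for j
    using dens[OF that] sp[OF that] by (auto simp: prob_density_def)
  have u: "hat d i (x i) \<in> space (euc {..<d (Suc i)})"
    using sp[of i] iL by (intro measurable_space[OF measurable_hat[of d, OF dim_dec iL]]) auto
  have p: "0 \<le> \<pi> (Suc i) (hat d i (x i))"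
    using dens[of "Suc i"] iL u by (auto simp: prob_density_def)
  define P where "P = (\<Prod>j\<in>{..L} - {i, Suc i}. \<pi> j (x j))"
  have "{..L} = insert i (insert (Suc i) ({..L} - {i, Suc i}))"
    using iL by auto
  then have "product_density L \<pi> x = P * \<pi> i (x i) * \<pi> (Suc i) (x (Suc i))"
    unfolding product_density_def P_def
    by (subst \<open>{..L} = _\<close>, subst prod.insert, simp, simp, subst prod.insert)
      (simp_all add: ac_simps)
  moreover have "0 \<le> P"
    unfolding P_def using nonneg by (intro prod_nonneg) auto
  ultimately have \<Pi>: "ennreal (product_density L \<pi> x) =
      ennreal P * ennreal (\<pi> i (x i)) * ennreal (\<pi> (Suc i) (x (Suc i)))"
    using nonneg iL by (simp add: ennreal_mult)
  show ?thesis
  proof (cases "marginal d \<pi> i (x (Suc i)) \<in> {0, \<infinity>} \<or>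
      marginal d \<pi> i (hat d i (x i)) \<in> {0, \<infinity>} \<or> \<pi> (Suc i) (x (Suc i)) = 0")
    case True
    then show ?thesis
      by (auto simp: acceptance_def flux_def level_ratio_def)
  next
    case False
    then have "ennreal (\<pi> (Suc i) (x (Suc i))) * acceptance d \<pi> i x *
        conditional d \<pi> \<rho> i (x (Suc i)) w =
        ennreal (\<pi> i (join_coords d i (x (Suc i)) w)) *
        min (level_ratio d \<pi> i (x (Suc i))) (level_ratio d \<pi> i (hat d i (x i)))"
      using min_acceptance_ratio[of "marginal d \<pi> i (hat d i (x i))" "marginal d \<pi> i (x (Suc i))"
          "\<pi> (Suc i) (hat d i (x i))" "\<pi> (Suc i) (x (Suc i))"] p nonneg[of "Suc i"] iL
      by (simp add: acceptance_def conditional_def level_ratio_def)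
    then show ?thesis
      by (simp add: \<Pi> flux_def P_def mult.assoc)
  qed
qed

text \<open>
  The accepted part is expressed through the flux even where the acceptance probability is \<open>0\<close>:
  the conditional density may be the fallback there, but the flux vanishes.
\<close>

lemma density_emeasure_swap_kernel:
  assumes x: "x \<in> space (state L d)" and B: "B \<in> sets (state L d)"
  shows "ennreal (product_density L \<pi> x) * emeasure (swap_kernel L d \<pi> \<rho> i x) B =
    ennreal (product_density L \<pi> x) * (1 - acceptance d \<pi> i x) * indicator B x +
    (\<integral>\<^sup>+w. flux L d \<pi> i x w * indicator B (swap_point d i x w) \<partial>euc {d (Suc i)..<d i})"
proof -
  let ?c = "conditional d \<pi> \<rho> i (x (Suc i))"
  have u: "x (Suc i) \<in> space (euc {..<d (Suc i)})"
    using x iL by (auto simp: state_def space_PiM)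
  have "ennreal (product_density L \<pi> x) * (acceptance d \<pi> i x * emeasure (proposal L d \<pi> \<rho> i x) B) =
    (\<integral>\<^sup>+w. flux L d \<pi> i x w * indicator B (swap_point d i x w) \<partial>euc {d (Suc i)..<d i})"
  proof (cases "acceptance d \<pi> i x = 0")
    case True
    then have "flux L d \<pi> i x w = 0" if "w \<in> space (euc {d (Suc i)..<d i})" for w
      using density_acceptance_conditional[OF x that] by simp
    with True show ?thesis
      by (simp cong: nn_integral_cong)
  next
    case False
    then have c: "?c = (\<lambda>w. ennreal (\<pi> i (join_coords d i (x (Suc i)) w)) / marginal d \<pi> i (x (Suc i)))"
      by (auto simp: acceptance_def conditional_def split: if_splits)
    note [measurable] = B
    have cm: "(\<lambda>w. ?c w * indicator B (swap_point d i x w)) \<in> borel_measurable (euc {d (Suc i)..<d i})"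
      unfolding c using x u by measurable
    have "emeasure (proposal L d \<pi> \<rho> i x) B =
        (\<integral>\<^sup>+w. ?c w * indicator B (swap_point d i x w) \<partial>euc {d (Suc i)..<d i})"
      by (rule emeasure_proposal[of L d \<pi> \<rho> i, OF d_dec dens fallback iL x B])
    then have "ennreal (product_density L \<pi> x) * (acceptance d \<pi> i x * emeasure (proposal L d \<pi> \<rho> i x) B) =
        (\<integral>\<^sup>+w. (ennreal (product_density L \<pi> x) * acceptance d \<pi> i x) *
          (?c w * indicator B (swap_point d i x w)) \<partial>euc {d (Suc i)..<d i})"
      by (subst nn_integral_cmult[OF cm]) (simp add: mult.assoc)
    also have "\<dots> = (\<integral>\<^sup>+w. flux L d \<pi> i x w * indicator B (swap_point d i x w) \<partial>euc {d (Suc i)..<d i})"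
      by (intro nn_integral_cong) (simp add: density_acceptance_conditional[OF x, symmetric] mult.assoc)
    finally show ?thesis .
  qed
  then show ?thesis
    using B by (simp add: emeasure_swap_kernel distrib_left mult.assoc)
qed

lemma detailed_balance_swap_kernel:
  "detailed_balance (state L d) (product_density L \<pi>) (swap_kernel L d \<pi> \<rho> i)"
proof (rule detailed_balanceI)
  show "swap_kernel L d \<pi> \<rho> i \<in> state L d \<rightarrow>\<^sub>M prob_algebra (state L d)"
    by (rule measurable_swap_kernel[of L d \<pi> \<rho> i, OF d_dec dens fallback iL])
  interpret w: sigma_finite_measure "euc {d (Suc i)..<d i}"
    by (rule sigma_finite_euc) simp
  fix A assume A: "A \<in> sets (state L d \<Otimes>\<^sub>M state L d)"
  define rejected where "rejected B =
    (\<integral>\<^sup>+x. ennreal (product_density L \<pi> x) * (1 - acceptance d \<pi> i x) * indicator B (x, x) \<partial>state L d)"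
    for B :: "((nat \<Rightarrow> nat \<Rightarrow> real) \<times> (nat \<Rightarrow> nat \<Rightarrow> real)) set"
  define accepted where "accepted B =
    (\<integral>\<^sup>+x. \<integral>\<^sup>+w. flux L d \<pi> i x w * indicator B (x, swap_point d i x w)
      \<partial>euc {d (Suc i)..<d i} \<partial>state L d)"
    for B :: "((nat \<Rightarrow> nat \<Rightarrow> real) \<times> (nat \<Rightarrow> nat \<Rightarrow> real)) set"
  have split: "(\<integral>\<^sup>+x. ennreal (product_density L \<pi> x) *
      emeasure (swap_kernel L d \<pi> \<rho> i x) (Pair x -` B) \<partial>state L d) = rejected B + accepted B"
    if B [measurable]: "B \<in> sets (state L d \<Otimes>\<^sub>M state L d)" for B
  proof -
    have "(\<integral>\<^sup>+x. ennreal (product_density L \<pi> x) *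
        emeasure (swap_kernel L d \<pi> \<rho> i x) (Pair x -` B) \<partial>state L d) =
      (\<integral>\<^sup>+x. ennreal (product_density L \<pi> x) * (1 - acceptance d \<pi> i x) * indicator B (x, x) +
        (\<integral>\<^sup>+w. flux L d \<pi> i x w * indicator B (x, swap_point d i x w) \<partial>euc {d (Suc i)..<d i}) \<partial>state L d)"
      by (intro nn_integral_cong)
        (simp add: density_emeasure_swap_kernel sets_Pair1[OF B] indicator_def)
    also have "\<dots> = rejected B + accepted B"
      unfolding rejected_def accepted_def by (rule nn_integral_add) measurable
    finally show ?thesis .
  qed
  have "rejected A = rejected (A\<inverse>)"
    by (simp add: rejected_def indicator_def)
  moreover have "accepted A = accepted (A\<inverse>)"
  proof -
    note [measurable] = A
    \<comment> \<open>Exchanging the two points turns the pair (state, proposal) into (proposal, state).\<close>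
    have "accepted A = (\<integral>\<^sup>+x. \<integral>\<^sup>+w. flux L d \<pi> i (swap_point d i x w) (tilde d i (x i)) *
        indicator A (swap_point d i x w, swap_point d i (swap_point d i x w) (tilde d i (x i)))
        \<partial>euc {d (Suc i)..<d i} \<partial>state L d)"
      unfolding accepted_def
      by (rule nn_integral_swap_point[of d, OF dim_dec iL, symmetric]) measurable
    also have "\<dots> = accepted (A\<inverse>)"
      unfolding accepted_def
      by (intro nn_integral_cong)
        (simp add: flux_swap_point[OF dim_dec iL] swap_point_swap_point[OF dim_dec iL] indicator_def)
    finally show ?thesis .
  qed
  ultimately show "(\<integral>\<^sup>+x. ennreal (product_density L \<pi> x) *
      emeasure (swap_kernel L d \<pi> \<rho> i x) (Pair x -` A) \<partial>state L d) =
    (\<integral>\<^sup>+x. ennreal (product_density L \<pi> x) *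
      emeasure (swap_kernel L d \<pi> \<rho> i x) (Pair x -` (A\<inverse>)) \<partial>state L d)"
    by (simp only: split[OF A] split[OF converse_in_sets_pair[OF A]])
qed simp

end

theorem lemma1:
  fixes L :: nat and d :: "nat \<Rightarrow> nat"
    and \<pi> :: "nat \<Rightarrow> (nat \<Rightarrow> real) \<Rightarrow> real"
    and \<rho> :: "nat \<Rightarrow> (nat \<Rightarrow> real) \<Rightarrow> (nat \<Rightarrow> real) \<Rightarrow> real"
  assumes "1 \<le> L"
    and "\<And>j. j < L \<Longrightarrow> d (Suc j) < d j"
    and "1 \<le> d L"
    and "\<And>j. j \<le> L \<Longrightarrow> prob_density (euc {..<d j}) (\<pi> j)"
    and "\<And>j u. j < L \<Longrightarrow> u \<in> space (euc {..<d (Suc j)}) \<Longrightarrow>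
          prob_density (euc {d (Suc j)..<d j}) (\<rho> j u)"
  shows "\<forall>i\<in>{0..L - 1}. detailed_balance (state L d) (product_density L \<pi>) (swap_kernel L d \<pi> \<rho> i)"
proof
  fix i assume "i \<in> {0..L - 1}"
  then have "i < L"
    using assms(1) by auto
  then show "detailed_balance (state L d) (product_density L \<pi>) (swap_kernel L d \<pi> \<rho> i)"
    by (intro detailed_balance_swap_kernel assms(2,4,5))
qed

end
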